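(* Let $\alpha>0$, $\beta>0$, let $n\ge 1$ be an integer, let $\gamma\in(0,1)$, and let $R_0,R_1,\dots,R_n$ be the first $n+1$ upper record values from the Weibull distribution $W(\alpha,\beta)$. Then $$\left(\frac{\chi^2_{(2n),\gamma/2}}{2\sum_{i=0}^n\log\left(\frac{R_n}{R_i}\right)},\ \frac{\chi^2_{(2n),1-\gamma/2}}{2\sum_{i=0}^n\log\left(\frac{R_n}{R_i}\right)}\right)$$ is an exact $100(1-\gamma)\%$ confidence interval for $\beta$; that is, for all $\alpha,\beta>0$ the probability that this random interval contains $\beta$ is equal to $1-\gamma$.
   Context: The Weibull distribution $W(\alpha,\beta)$ with parameters $\alpha,\beta>0$ has cumulative distribution function $F(x)=1-e^{-(x/\alpha)^\beta}$ for $x>0$. Upper record values: let $X_1,X_2,\dots$ be an infinite sequence of independent identically distributed random variables with the given distribution. Set $T_0=1$ and, for $k\ge 1$, $T_k=\min\{j: X_j>X_{T_{k-1}}\}$ (almost surely finite here). The upper record values are $R_k=X_{T_k}$, $k=0,1,2,\dots$. $\chi^2_{(k),\delta}$ denotes the $\delta$-quantile of the chi-square distribution with $k$ degrees of freedom, i.e. the point $c$ with $P(\chi^2_{(k)}\le c)=\delta$. *)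

theory Defs
  imports "HOL-Probability.Probability"
begin

definition weibull_cdf :: "real \<Rightarrow> real \<Rightarrow> real \<Rightarrow> real" where
  "weibull_cdf \<alpha> \<beta> x = (if x > 0 then 1 - exp (- ((x / \<alpha>) powr \<beta>)) else 0)"

(* Sequences are indexed from 0: X j is the (j+1)-st observation, so the first record
   time is 0 and all record times are one less than in the 1-based convention.
   If no later observation exceeds the current record (probability 0 for continuous
   distributions), LEAST yields a fixed but unspecified index. *)
fun record_time :: "(nat \<Rightarrow> 'a \<Rightarrow> real) \<Rightarrow> nat \<Rightarrow> 'a \<Rightarrow> nat" where
  "record_time X 0 \<omega> = 0"
| "record_time X (Suc k) \<omega> = (LEAST j. X j \<omega> > X (record_time X k \<omega>) \<omega>)"

definition record_value :: "(nat \<Rightarrow> 'a \<Rightarrow> real) \<Rightarrow> nat \<Rightarrow> 'a \<Rightarrow> real" where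
  "record_value X k \<omega> = X (record_time X k \<omega>) \<omega>"

definition chi_square_density :: "nat \<Rightarrow> real \<Rightarrow> real" where
  "chi_square_density k x =
     (if x > 0
      then x powr (real k / 2 - 1) * exp (- x / 2) / (2 powr (real k / 2) * Gamma (real k / 2))
      else 0)"

(* Meaningful for k > 0 only. *)
definition chi_square :: "nat \<Rightarrow> real measure" where
  "chi_square k = density lborel (\<lambda>x. ennreal (chi_square_density k x))"

(* The point c is unique for k > 0 and 0 < \<delta> < 1. *)
definition chi_square_quantile :: "nat \<Rightarrow> real \<Rightarrow> real" where
  "chi_square_quantile k \<delta> = (THE c. measure (chi_square k) {..c} = \<delta>)"

end

(*
  Put Y_j = (X_j / alpha) powr beta, which are i.i.d. Exp(1), and let S_k be the records of Y;
  then beta * ln (R_n / R_i) = ln (S_n / S_i).  By memorylessness S_{k+1} - S_k is Exp(1) and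
  independent of the past.  For T_k = 2 * sum_{i<=k} ln (S_k / S_i) one has
  T_{k+1} = T_k + 2 (k+1) ln (S_{k+1} / S_k).  Given S_{k+1} = y, the density of S_k is
  proportional to s^k on (0, y), so the increment of T is Exp(1/2) and independent of S_{k+1}.
  Hence S_k and T_k are independent, and T_n, a sum of n independent Exp(1/2) variables, is
  chi-square distributed with 2n degrees of freedom.
*)
theory Submission
  imports Defs
begin

section \<open>Strong Markov property at the first exceedance\<close>

text \<open>The obstacle is the random search: \<open>record_time\<close> scans the whole sequence
  from index 0, so independence of a new record from the past is a strong Markov statement at a
  random index. It comes from conditioning on one entry: a search for an entry above s restarts
  unchanged whenever an entry fails, so every expectation at the first exceedance solves a linear
  equation, and no sum over the index occurs. To iterate this, the chain carries the unread
  remainder of the stream next to S_k and T_k. The inductive claim is joint independence of all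
  three, with a remainder distributed like a fresh stream; independence of S_k and T_k alone would
  say nothing about the next record. The factor 2 in T_k turns rate 1 into the rate 1/2 of the
  chi-square law.\<close>

definition exceed_index :: "real \<Rightarrow> real stream \<Rightarrow> nat" where
  "exceed_index s \<omega> = (LEAST j. s < \<omega> !! j)"

definition exceed_value :: "real \<Rightarrow> real stream \<Rightarrow> real" where
  "exceed_value s \<omega> = \<omega> !! exceed_index s \<omega>"

definition exceed_rest :: "real \<Rightarrow> real stream \<Rightarrow> real stream" where
  "exceed_rest s \<omega> = sdrop (Suc (exceed_index s \<omega>)) \<omega>"

text \<open>Measurability is joint in the level and the stream because the level will be the
  previous record, which is itself random.\<close>

lemma measurable_exceed_index [measurable]:
  "(\<lambda>(s, \<omega>). exceed_index s \<omega>) \<in> measurable (borel \<Otimes>\<^sub>M stream_space borel) (count_space UNIV)"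
  unfolding exceed_index_def by measurable

lemma measurable_exceed_value [measurable]:
  "(\<lambda>(s, \<omega>). exceed_value s \<omega>) \<in> borel_measurable (borel \<Otimes>\<^sub>M stream_space borel)"
proof -
  have "(\<lambda>x. (\<lambda>i x. snd x !! i) ((\<lambda>(s, \<omega>). exceed_index s \<omega>) x) x)
      \<in> borel_measurable (borel \<Otimes>\<^sub>M stream_space borel)"
    by (rule measurable_compose_countable) measurable
  then show ?thesis by (simp add: exceed_value_def case_prod_beta)
qed

lemma measurable_exceed_rest [measurable]:
  "(\<lambda>(s, \<omega>). exceed_rest s \<omega>)
    \<in> measurable (borel \<Otimes>\<^sub>M stream_space borel) (stream_space borel)"
proof -
  have "(\<lambda>x. (\<lambda>i x. sdrop (Suc i) (snd x)) ((\<lambda>(s, \<omega>). exceed_index s \<omega>) x) x)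
      \<in> measurable (borel \<Otimes>\<^sub>M stream_space borel) (stream_space borel)"
    by (rule measurable_compose_countable) measurable
  then show ?thesis by (simp add: exceed_rest_def case_prod_beta del: sdrop.simps)
qed

text \<open>When the head is discarded, an exceedance in the tail must exist: otherwise both
  \<open>LEAST\<close> terms are unspecified and need not differ by one.\<close>

lemma exceed_index_Stream:
  "s < y \<Longrightarrow> exceed_index s (y ## \<omega>) = 0"
  "\<lbrakk>\<not> s < y; \<exists>j. s < \<omega> !! j\<rbrakk> \<Longrightarrow> exceed_index s (y ## \<omega>) = Suc (exceed_index s \<omega>)"
proof -
  show "s < y \<Longrightarrow> exceed_index s (y ## \<omega>) = 0"
    unfolding exceed_index_def by (rule Least_equality) auto
  assume y: "\<not> s < y" and "\<exists>j. s < \<omega> !! j"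
  then obtain j where "s < \<omega> !! j" by blast
  then show "exceed_index s (y ## \<omega>) = Suc (exceed_index s \<omega>)"
    unfolding exceed_index_def using y by (subst Least_Suc[of _ "Suc j"]) auto
qed

lemma exceed_Stream:
  assumes "\<exists>j. s < \<omega> !! j"
  shows "exceed_value s (y ## \<omega>) = (if s < y then y else exceed_value s \<omega>)"
    and "exceed_rest s (y ## \<omega>) = (if s < y then \<omega> else exceed_rest s \<omega>)"
  using assms by (simp_all add: exceed_value_def exceed_rest_def exceed_index_Stream)

locale real_prob = prob_space \<mu> for \<mu> :: "real measure" +
  assumes sets_borel [simp, measurable_cong]: "sets \<mu> = sets borel"
begin

abbreviation "S \<equiv> stream_space \<mu>"

lemma space_borel [simp]: "space \<mu> = UNIV"
  using sets_eq_imp_space_eq[OF sets_borel] by simp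

lemma space_S [simp]: "space S = UNIV"
  by (simp add: space_stream_space)

lemma sets_S [measurable_cong]: "sets S = sets (stream_space borel)"
  by (intro sets_stream_space_cong sets_borel)

sublocale S: prob_space S by (rule prob_space_stream_space)

lemma emeasure_atMost_greaterThan:
  "emeasure \<mu> {..s} + emeasure \<mu> {s<..} = 1"
proof -
  have "emeasure \<mu> {..s} + emeasure \<mu> {s<..} = emeasure \<mu> ({..s} \<union> {s<..})"
    by (rule plus_emeasure) auto
  also have "{..s} \<union> {s<..} = (UNIV :: real set)" by auto
  finally show ?thesis using emeasure_space_1 by simp
qed

text \<open>The masses below and above s add up to 1, so g splits into two parts, one of which also
  occurs in the assumed equation. The bound on g makes this part finite, as cancellation in
  \<open>ennreal\<close> requires.\<close>

lemma ennreal_renewal_equation: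
  fixes g :: ennreal
  assumes "g = a + emeasure \<mu> {..s} * g" and "g \<le> 1"
  shows "emeasure \<mu> {s<..} * g = a"
proof -
  have "emeasure \<mu> {..s} * g + emeasure \<mu> {s<..} * g = g"
    using emeasure_atMost_greaterThan[of s] by (simp flip: distrib_right)
  also have "\<dots> = emeasure \<mu> {..s} * g + a" using assms(1) by (simp add: add.commute)
  finally have eq: "emeasure \<mu> {..s} * g + emeasure \<mu> {s<..} * g = emeasure \<mu> {..s} * g + a" .
  have "emeasure \<mu> {..s} * g \<le> 1 * 1"
    using assms(2) by (intro mult_mono emeasure_le_1) auto
  then have "emeasure \<mu> {..s} * g \<noteq> \<top>" using neq_top_trans by force
  with eq show ?thesis by (simp add: ennreal_add_left_cancel)
qed

text \<open>A stream never exceeds s iff its head does not and its tail never does. The probability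
  of this event thus solves the renewal equation with a = 0, and the positive tail mass forces it to
  vanish.\<close>

lemma AE_exceeds:
  assumes "emeasure \<mu> {s<..} \<noteq> 0"
  shows "AE \<omega> in S. \<exists>j. s < \<omega> !! j"
proof -
  let ?N = "{\<omega>. \<forall>j. \<not> s < \<omega> !! j}"
  have "{\<omega>\<in>space S. \<forall>j. \<not> s < \<omega> !! j} \<in> sets S" by measurable
  then have meas [measurable]: "?N \<in> sets S" by simp
  have "emeasure S ?N = (\<integral>\<^sup>+y. \<integral>\<^sup>+\<omega>. indicator ?N (y ## \<omega>) \<partial>S \<partial>\<mu>)"
    using nn_integral_stream_space[of "indicator ?N"] by simp
  also have "\<dots> = (\<integral>\<^sup>+y. indicator {..s} y * emeasure S ?N \<partial>\<mu>)"
  proof (rule nn_integral_cong)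
    fix y
    have split: "(\<forall>j. P j) \<longleftrightarrow> P 0 \<and> (\<forall>j. P (Suc j))" for P :: "nat \<Rightarrow> bool"
      by (metis nat.exhaust)
    have "(y ## \<omega> \<in> ?N) = (y \<le> s \<and> \<omega> \<in> ?N)" for \<omega>
      unfolding mem_Collect_eq by (subst split) (simp add: not_less)
    then have "(\<integral>\<^sup>+\<omega>. indicator ?N (y ## \<omega>) \<partial>S) = (\<integral>\<^sup>+\<omega>. indicator {..s} y * indicator ?N \<omega> \<partial>S)"
      by (intro nn_integral_cong) (simp add: indicator_def)
    then show "(\<integral>\<^sup>+\<omega>. indicator ?N (y ## \<omega>) \<partial>S) = indicator {..s} y * emeasure S ?N"
      by (simp add: nn_integral_cmult)
  qed
  also have "\<dots> = 0 + emeasure \<mu> {..s} * emeasure S ?N"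
    by (simp add: nn_integral_multc)
  finally have "emeasure \<mu> {s<..} * emeasure S ?N = 0"
    by (rule ennreal_renewal_equation) (rule S.emeasure_le_1)
  with assms have "emeasure S ?N = 0" by simp
  then show ?thesis by (subst AE_iff_measurable[OF meas]) auto
qed

text \<open>The left-hand integral satisfies a renewal equation under conditioning on the first
  entry, which either already exceeds \<open>s\<close> or is discarded.\<close>

lemma nn_integral_exceed:
  assumes f [measurable]: "case_prod f \<in> borel_measurable (borel \<Otimes>\<^sub>M stream_space borel)"
    and le: "\<And>y \<omega>. f y \<omega> \<le> 1" and pos: "emeasure \<mu> {s<..} \<noteq> 0"
  shows "emeasure \<mu> {s<..} * (\<integral>\<^sup>+\<omega>. f (exceed_value s \<omega>) (exceed_rest s \<omega>) \<partial>S)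
    = (\<integral>\<^sup>+y. indicator {s<..} y * (\<integral>\<^sup>+\<omega>. f y \<omega> \<partial>S) \<partial>\<mu>)"
proof (rule ennreal_renewal_equation)
  let ?g = "\<lambda>\<omega>. f (exceed_value s \<omega>) (exceed_rest s \<omega>)"
  let ?G = "\<integral>\<^sup>+\<omega>. ?g \<omega> \<partial>S"
  have [measurable]: "(\<lambda>\<omega>. exceed_value s \<omega>) \<in> borel_measurable (stream_space borel)"
    "(\<lambda>\<omega>. exceed_rest s \<omega>) \<in> measurable (stream_space borel) (stream_space borel)"
    using measurable_Pair2[OF measurable_exceed_value, of s]
      measurable_Pair2[OF measurable_exceed_rest, of s] by simp_all
  have [measurable]: "?g \<in> borel_measurable S" by measurable
  have "?G \<le> (\<integral>\<^sup>+\<omega>. 1 \<partial>S)" by (intro nn_integral_mono le)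
  then show "?G \<le> 1" using S.emeasure_space_1 by simp
  have "?G = (\<integral>\<^sup>+y. \<integral>\<^sup>+\<omega>. ?g (y ## \<omega>) \<partial>S \<partial>\<mu>)"
    by (rule nn_integral_stream_space) simp
  also have "\<dots> = (\<integral>\<^sup>+y. indicator {s<..} y * (\<integral>\<^sup>+\<omega>. f y \<omega> \<partial>S) + indicator {..s} y * ?G \<partial>\<mu>)"
  proof (rule nn_integral_cong)
    fix y
    have "(\<integral>\<^sup>+\<omega>. ?g (y ## \<omega>) \<partial>S) = (\<integral>\<^sup>+\<omega>. (if s < y then f y \<omega> else ?g \<omega>) \<partial>S)"
      using AE_exceeds[OF pos] by (intro nn_integral_cong_AE) (auto simp: exceed_Stream)
    then show "(\<integral>\<^sup>+\<omega>. ?g (y ## \<omega>) \<partial>S)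
        = indicator {s<..} y * (\<integral>\<^sup>+\<omega>. f y \<omega> \<partial>S) + indicator {..s} y * ?G"
      by (auto simp: indicator_def)
  qed
  also have "\<dots> = (\<integral>\<^sup>+y. indicator {s<..} y * (\<integral>\<^sup>+\<omega>. f y \<omega> \<partial>S) \<partial>\<mu>) + emeasure \<mu> {..s} * ?G"
    by (subst nn_integral_add) (simp_all add: nn_integral_multc)
  finally show "?G = \<dots>" .
qed

end

section \<open>The law of the record chain\<close>

abbreviation exponential :: "real \<Rightarrow> real measure" where
  "exponential l \<equiv> density lborel (exponential_density l)"

interpretation expo: real_prob "exponential 1"
  by (rule real_prob.intro) (auto intro: prob_space_exponential_density real_prob_axioms.intro)

interpretation expo_half: prob_space "exponential (1/2)"
  by (rule prob_space_exponential_density) simp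

lemma emeasure_exponential_greaterThan:
  assumes "0 \<le> s"
  shows "emeasure (exponential 1) {s<..} = ennreal (exp (- s))"
proof -
  have "ennreal (1 - exp (- s)) + emeasure (exponential 1) {s<..} = 1"
    using expo.emeasure_atMost_greaterThan[of s] emeasure_erlang_density[of 1 0 s] assms
    by (simp add: erlang_CDF_0)
  also have "1 = ennreal (1 - exp (- s)) + ennreal (exp (- s))"
    using assms by (simp flip: ennreal_plus)
  finally show ?thesis by (simp add: ennreal_add_left_cancel)
qed

text \<open>The density is that of the maximum of k+1 independent uniform variables on (0, y), so s
  / y is distributed like U powr (1/(k+1)) with U uniform on (0, 1), and (k+1) ln (y / s) like - ln
  U, which is Exp(1).\<close>

lemma distributed_power_density_log:
  assumes y: "0 < y"
  shows "distributed (density lborel (\<lambda>s. ennreal (real (Suc k) * s ^ k / y ^ Suc k) * indicator {0<..y} s))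
    lborel (\<lambda>s. 2 * real (Suc k) * ln (y / s)) (exponential_density (1/2))"
    (is "distributed ?D _ ?u _")
proof (rule exponential_distributedI)
  fix a :: real assume a: "0 \<le> a"
  \<comment> \<open>b is the point s at which the transformed variable equals a. The transformation
    decreases in s, so the event becomes the interval from b to y.\<close>
  define b where "b = y * exp (- a / (2 * real (Suc k)))"
  have b: "0 < b" "b \<le> y" using y a by (auto simp: b_def)
  have iff: "?u s \<le> a \<longleftrightarrow> b \<le> s" if s: "0 < s" for s
  proof -
    have "?u s \<le> a \<longleftrightarrow> ln (y / s) \<le> a / (2 * real (Suc k))"
      by (simp add: field_simps)
    also have "\<dots> \<longleftrightarrow> y / s \<le> exp (a / (2 * real (Suc k)))"
      using y s by (simp add: ln_le_cancel_iff[symmetric, of _ "exp _"] del: ln_le_cancel_iff)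
    also have "\<dots> \<longleftrightarrow> b \<le> s"
      using s by (simp add: b_def exp_minus field_simps)
    finally show ?thesis .
  qed
  have "emeasure ?D {s\<in>space ?D. ?u s \<le> a}
      = (\<integral>\<^sup>+s. ennreal (real (Suc k) * s ^ k / y ^ Suc k) * indicator {b..y} s \<partial>lborel)"
    using b iff
    by (subst emeasure_density) (auto intro!: nn_integral_cong simp: indicator_def)
  also have "\<dots> = ennreal (y ^ Suc k / y ^ Suc k - b ^ Suc k / y ^ Suc k)"
    using b y
    by (intro nn_integral_FTC_Icc[where F = "\<lambda>s. s ^ Suc k / y ^ Suc k"])
       (auto intro!: derivative_eq_intros simp del: power_Suc)
  also have "b ^ Suc k / y ^ Suc k = exp (- a * (1/2))"
    using y by (simp add: b_def power_mult_distrib exp_of_nat_mult[symmetric] del: power_Suc of_nat_Suc)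
  finally show "emeasure ?D {s\<in>space ?D. ?u s \<le> a} = 1 - ennreal (exp (- a * (1/2)))"
    using y by (simp add: ennreal_minus flip: ennreal_1)
qed simp_all

lemma nn_integral_power_density_log:
  assumes y: "0 < y" and [measurable]: "g \<in> borel_measurable borel"
  shows "(\<integral>\<^sup>+s. ennreal (real (Suc k) * s ^ k / y ^ Suc k) * indicator {0<..y} s
      * g (2 * real (Suc k) * ln (y / s)) \<partial>lborel) = (\<integral>\<^sup>+u. g u \<partial>exponential (1/2))"
proof -
  let ?D = "density lborel (\<lambda>s. ennreal (real (Suc k) * s ^ k / y ^ Suc k) * indicator {0<..y} s)"
  let ?u = "\<lambda>s. 2 * real (Suc k) * ln (y / s)"
  have "(\<integral>\<^sup>+u. g u \<partial>exponential (1/2)) = (\<integral>\<^sup>+u. g u \<partial>distr ?D lborel ?u)"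
    using distributed_distr_eq_density[OF distributed_power_density_log[OF y, of k]] by simp
  also have "\<dots> = (\<integral>\<^sup>+s. g (?u s) \<partial>?D)" by (subst nn_integral_distr) auto
  finally show ?thesis by (subst (asm) (2) nn_integral_density) auto
qed

text \<open>The triple holds the current record, the statistic T_k and the part of the stream after
  the record time.\<close>

definition record_step :: "nat \<Rightarrow> real \<times> real \<times> real stream \<Rightarrow> real \<times> real \<times> real stream" where
  "record_step k = (\<lambda>(s, t, \<omega>). (exceed_value s \<omega>,
     t + 2 * real (Suc k) * ln (exceed_value s \<omega> / s), exceed_rest s \<omega>))"

fun record_state :: "nat \<Rightarrow> real stream \<Rightarrow> real \<times> real \<times> real stream" where
  "record_state 0 \<omega> = (shd \<omega>, 0, stl \<omega>)"
| "record_state (Suc k) \<omega> = record_step k (record_state k \<omega>)"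

abbreviation "state_space \<equiv> (borel \<Otimes>\<^sub>M (borel \<Otimes>\<^sub>M stream_space borel)
   :: (real \<times> real \<times> real stream) measure)"

lemma measurable_record_step [measurable]: "record_step k \<in> measurable state_space state_space"
  unfolding record_step_def by measurable

lemma measurable_record_state [measurable]:
  "record_state k \<in> measurable (stream_space borel) state_space"
proof (induction k)
  case 0
  have "(\<lambda>\<omega>. (shd \<omega>, 0, stl \<omega>)) \<in> measurable (stream_space borel) state_space" by measurable
  then show ?case by (simp cong: measurable_cong)
next
  case (Suc k)
  note [measurable] = Suc
  have "(\<lambda>\<omega>. record_step k (record_state k \<omega>)) \<in> measurable (stream_space borel) state_space"
    by measurable
  then show ?case by (simp cong: measurable_cong)
qed

section \<open>Iterated convolutions of Exp(1/2)\<close>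

fun exponential_sum :: "nat \<Rightarrow> real measure" where
  "exponential_sum 0 = return borel 0"
| "exponential_sum (Suc k) = (exponential_sum k \<star> exponential (1/2))"

lemma sets_exponential_sum [simp, measurable_cong]: "sets (exponential_sum k) = sets borel"
  by (cases k) auto

lemma space_exponential_sum [simp]: "space (exponential_sum k) = UNIV"
  using sets_eq_imp_space_eq[OF sets_exponential_sum, of k] by simp

lemma finite_measure_exponential: "0 < l \<Longrightarrow> finite_measure (exponential l)"
  by (intro prob_space.finite_measure prob_space_exponential_density)

lemma finite_measure_exponential_sum: "finite_measure (exponential_sum k)"
proof (induction k)
  case 0
  then show ?case by (simp add: prob_space.finite_measure prob_space_return)
next
  case (Suc k)
  then show ?case by (simp add: convolution_finite finite_measure_exponential)
qed

lemma nn_integral_exponential_sum_Suc: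
  assumes "f \<in> borel_measurable borel"
  shows "(\<integral>\<^sup>+t. f t \<partial>exponential_sum (Suc k))
    = (\<integral>\<^sup>+t. \<integral>\<^sup>+u. f (t + u) \<partial>exponential (1/2) \<partial>exponential_sum k)"
  using assms finite_measure_exponential_sum[of k]
  by (simp add: nn_integral_convolution finite_measure_exponential)

text \<open>The index shifts because \<open>erlang_density k\<close> is the density of a sum of k+1
  exponentials. The empty sum is a point mass without a density, hence the separate recursive
  definition, whose case 0 is the law of T_0 = 0.\<close>

lemma exponential_sum_eq_erlang: "exponential_sum (Suc k) = density lborel (erlang_density k (1/2))"
proof (induction k)
  case 0
  show ?case
  proof (rule measure_eqI)
    fix A assume "A \<in> sets (exponential_sum (Suc 0))"
    then have A [measurable]: "A \<in> sets borel" by simp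
    have "emeasure (exponential_sum (Suc 0)) A = (\<integral>\<^sup>+t. indicator A t \<partial>exponential_sum (Suc 0))"
      by (simp del: exponential_sum.simps)
    also have "\<dots> = (\<integral>\<^sup>+u. indicator A u \<partial>exponential (1/2))"
      by (subst nn_integral_exponential_sum_Suc, simp, simp only: exponential_sum.simps,
          subst nn_integral_return) (simp_all del: nn_integral_indicator)
    finally show "emeasure (exponential_sum (Suc 0)) A
        = emeasure (density lborel (erlang_density 0 (1/2))) A" by simp
  qed simp
next
  case (Suc k)
  have "exponential_sum (Suc (Suc k)) = (density lborel (erlang_density k (1/2)) \<star> exponential (1/2))"
    using Suc by simp
  also have "\<dots> = density lborel (\<lambda>x. \<integral>\<^sup>+y. ennreal (erlang_density k (1/2) (x - y))
      * ennreal (exponential_density (1/2) y) \<partial>lborel)"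
    by (rule convolution_density)
      (auto intro!: prob_space.finite_measure prob_space_erlang_density)
  also have "\<dots> = density lborel (erlang_density (Suc k) (1/2))"
    using convolution_erlang_density[of "1/2" k 0] by simp
  finally show ?case .
qed

text \<open>\<open>f\<close> is bounded only because the renewal argument cancels a finite integral.\<close>

lemma nn_integral_record_state:
  assumes "f \<in> borel_measurable state_space" and "\<And>x. f x \<le> 1"
  shows "(\<integral>\<^sup>+\<omega>. f (record_state k \<omega>) \<partial>expo.S)
    = (\<integral>\<^sup>+s. \<integral>\<^sup>+t. \<integral>\<^sup>+\<omega>. f (s, t, \<omega>) \<partial>expo.S \<partial>exponential_sum k \<partial>density lborel (erlang_density k 1))"
  using assms
proof (induction k arbitrary: f)
  case 0
  note [measurable] = 0(1)
  have "(\<integral>\<^sup>+\<omega>. f (record_state 0 \<omega>) \<partial>expo.S)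
      = (\<integral>\<^sup>+s. \<integral>\<^sup>+\<omega>. f (s, 0, \<omega>) \<partial>expo.S \<partial>exponential 1)"
    by (subst expo.nn_integral_stream_space) simp_all
  also have "\<dots> = (\<integral>\<^sup>+s. \<integral>\<^sup>+t. \<integral>\<^sup>+\<omega>. f (s, t, \<omega>) \<partial>expo.S \<partial>exponential_sum 0 \<partial>exponential 1)"
    by (intro nn_integral_cong) (simp add: nn_integral_return)
  finally show ?case .
next
  case (Suc k)
  note [measurable] = Suc.prems(1)
  interpret T: finite_measure "exponential_sum k" by (rule finite_measure_exponential_sum)
  interpret P: pair_sigma_finite lborel "exponential_sum k" ..
  define c where "c = 2 * real (Suc k)"
  define H where "H y t = (\<integral>\<^sup>+\<omega>. f (y, t, \<omega>) \<partial>expo.S)" for y t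
  have [measurable]: "case_prod H \<in> borel_measurable (borel \<Otimes>\<^sub>M borel)"
    unfolding H_def by measurable
  \<comment> \<open>w is the joint density of (S_k, S_{k+1}): the Erlang density at s, times exp s,
    times exp (- y). The factors exp (- s) and exp s cancel.\<close>
  define w where "w s y = (if 0 < s \<and> s < y then ennreal (s ^ k / fact k * exp (- y)) else 0)" for s y :: real
  have [measurable]: "case_prod w \<in> borel_measurable (borel \<Otimes>\<^sub>M borel)"
    unfolding w_def by measurable
  \<comment> \<open>The factor exp s is the reciprocal of the tail mass above s, so the right-hand
    side averages over an Exp(1) variable conditioned to exceed s.\<close>
  have step: "(\<integral>\<^sup>+\<omega>. f (record_step k (s, t, \<omega>)) \<partial>expo.S)
      = ennreal (exp s) * (\<integral>\<^sup>+y. indicator {s<..} y * H y (t + c * ln (y / s)) \<partial>exponential 1)"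
    if s: "0 < s" for s t
  proof -
    have "ennreal (exp (- s)) * (\<integral>\<^sup>+\<omega>. f (record_step k (s, t, \<omega>)) \<partial>expo.S)
        = (\<integral>\<^sup>+y. indicator {s<..} y * H y (t + c * ln (y / s)) \<partial>exponential 1)"
      using expo.nn_integral_exceed[of "\<lambda>y \<omega>. f (y, t + c * ln (y / s), \<omega>)" s] s Suc.prems(2)
      by (simp add: emeasure_exponential_greaterThan record_step_def H_def c_def)
    then have "ennreal (exp s) * (\<integral>\<^sup>+y. indicator {s<..} y * H y (t + c * ln (y / s)) \<partial>exponential 1)
        = (ennreal (exp s) * ennreal (exp (- s))) * (\<integral>\<^sup>+\<omega>. f (record_step k (s, t, \<omega>)) \<partial>expo.S)"
      by (simp add: mult.assoc)
    also have "ennreal (exp s) * ennreal (exp (- s)) = 1"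
      by (simp add: ennreal_mult[symmetric] exp_minus)
    finally show ?thesis by simp
  qed
  have "(\<integral>\<^sup>+\<omega>. f (record_state (Suc k) \<omega>) \<partial>expo.S)
      = (\<integral>\<^sup>+s. \<integral>\<^sup>+t. \<integral>\<^sup>+\<omega>. f (record_step k (s, t, \<omega>)) \<partial>expo.S \<partial>exponential_sum k
          \<partial>density lborel (erlang_density k 1))"
    using Suc.IH[of "\<lambda>x. f (record_step k x)"] Suc.prems(2) by simp
  also have "\<dots> = (\<integral>\<^sup>+s. ennreal (erlang_density k 1 s) *
      (\<integral>\<^sup>+t. \<integral>\<^sup>+\<omega>. f (record_step k (s, t, \<omega>)) \<partial>expo.S \<partial>exponential_sum k) \<partial>lborel)"
    by (subst nn_integral_density) simp_all
  also have "\<dots> = (\<integral>\<^sup>+s. \<integral>\<^sup>+t. \<integral>\<^sup>+y. w s y * H y (t + c * ln (y / s)) \<partial>lborel \<partial>exponential_sum k \<partial>lborel)"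
  \<comment> \<open>The point 0 is set aside because for k = 0 the Erlang density is 1 there, while
    w vanishes.\<close>
  proof (rule nn_integral_cong_AE, rule AE_mp[OF AE_lborel_singleton[of 0]], rule AE_I2, rule impI)
    fix s :: real assume "s \<noteq> 0"
    show "ennreal (erlang_density k 1 s) *
        (\<integral>\<^sup>+t. \<integral>\<^sup>+\<omega>. f (record_step k (s, t, \<omega>)) \<partial>expo.S \<partial>exponential_sum k)
      = (\<integral>\<^sup>+t. \<integral>\<^sup>+y. w s y * H y (t + c * ln (y / s)) \<partial>lborel \<partial>exponential_sum k)"
    proof (cases "0 < s")
      case True
      have "ennreal (erlang_density k 1 s) * (\<integral>\<^sup>+\<omega>. f (record_step k (s, t, \<omega>)) \<partial>expo.S)
          = (\<integral>\<^sup>+y. w s y * H y (t + c * ln (y / s)) \<partial>lborel)" for t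
      proof -
        have "ennreal (erlang_density k 1 s) * (\<integral>\<^sup>+\<omega>. f (record_step k (s, t, \<omega>)) \<partial>expo.S)
          = (ennreal (erlang_density k 1 s) * ennreal (exp s)) *
             (\<integral>\<^sup>+y. ennreal (exponential_density 1 y) * (indicator {s<..} y * H y (t + c * ln (y / s))) \<partial>lborel)"
          using True by (subst step) (simp_all add: nn_integral_density mult.assoc)
        also have "\<dots> = (\<integral>\<^sup>+y. (ennreal (erlang_density k 1 s) * ennreal (exp s)) *
            (ennreal (exponential_density 1 y) * (indicator {s<..} y * H y (t + c * ln (y / s)))) \<partial>lborel)"
          by (subst nn_integral_cmult) simp_all
        also have "\<dots> = (\<integral>\<^sup>+y. w s y * H y (t + c * ln (y / s)) \<partial>lborel)"
        proof (rule nn_integral_cong)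
          fix y
          have "erlang_density k 1 s * exp s * exponential_density 1 y = s ^ k / fact k * exp (- y)" if "s < y"
            using True that by (simp add: erlang_density_def exp_minus)
          then show "(ennreal (erlang_density k 1 s) * ennreal (exp s)) *
            (ennreal (exponential_density 1 y) * (indicator {s<..} y * H y (t + c * ln (y / s))))
            = w s y * H y (t + c * ln (y / s))"
            using True by (auto simp: w_def indicator_def mult.assoc[symmetric] ennreal_mult[symmetric])
        qed
        finally show ?thesis .
      qed
      then show ?thesis
        by (subst nn_integral_cmult[symmetric]) simp_all
    next
      case False
      with \<open>s \<noteq> 0\<close> show ?thesis by (simp add: w_def erlang_density_def)
    qed
  qed
  \<comment> \<open>The order of integration is changed until s is innermost, so that the next
    record y is held fixed while the current one varies.\<close>
  also have "\<dots> = (\<integral>\<^sup>+t. \<integral>\<^sup>+s. \<integral>\<^sup>+y. w s y * H y (t + c * ln (y / s)) \<partial>lborel \<partial>lborel \<partial>exponential_sum k)"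
    by (rule P.Fubini'[symmetric]) measurable
  also have "\<dots> = (\<integral>\<^sup>+t. \<integral>\<^sup>+y. \<integral>\<^sup>+s. w s y * H y (t + c * ln (y / s)) \<partial>lborel \<partial>lborel \<partial>exponential_sum k)"
    by (intro nn_integral_cong lborel_pair.Fubini') measurable
  also have "\<dots> = (\<integral>\<^sup>+y. \<integral>\<^sup>+t. \<integral>\<^sup>+s. w s y * H y (t + c * ln (y / s)) \<partial>lborel \<partial>exponential_sum k \<partial>lborel)"
    by (rule P.Fubini') measurable
  \<comment> \<open>The weight w factors into the density of S_{k+1} at y and the conditional power
    density of S_k given y. Under the latter the increment of T is Exp(1/2) whatever y is, which
    yields the independence.\<close>
  also have "\<dots> = (\<integral>\<^sup>+y. ennreal (erlang_density (Suc k) 1 y) *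
      (\<integral>\<^sup>+t. \<integral>\<^sup>+u. H y (t + u) \<partial>exponential (1/2) \<partial>exponential_sum k) \<partial>lborel)"
  proof (rule nn_integral_cong)
    fix y :: real
    have "(\<integral>\<^sup>+s. w s y * H y (t + c * ln (y / s)) \<partial>lborel)
        = ennreal (erlang_density (Suc k) 1 y) * (\<integral>\<^sup>+u. H y (t + u) \<partial>exponential (1/2))" for t
    proof (cases "0 < y")
      case True
      have "(\<integral>\<^sup>+s. w s y * H y (t + c * ln (y / s)) \<partial>lborel)
        = (\<integral>\<^sup>+s. ennreal (erlang_density (Suc k) 1 y) * (ennreal (real (Suc k) * s ^ k / y ^ Suc k)
            * indicator {0<..y} s * H y (t + c * ln (y / s))) \<partial>lborel)"
      \<comment> \<open>The two integrands may differ at s = y, which w excludes and the power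
        density includes.\<close>
      proof (rule nn_integral_cong_AE, rule AE_mp[OF AE_lborel_singleton[of y]], rule AE_I2, rule impI)
        fix s :: real assume "s \<noteq> y"
        have "erlang_density (Suc k) 1 y * (real (Suc k) * s ^ k / y ^ Suc k) = s ^ k / fact k * exp (- y)"
          using True by (simp add: erlang_density_def field_simps del: power_Suc of_nat_Suc)
        then show "w s y * H y (t + c * ln (y / s)) = ennreal (erlang_density (Suc k) 1 y) *
            (ennreal (real (Suc k) * s ^ k / y ^ Suc k) * indicator {0<..y} s * H y (t + c * ln (y / s)))"
          using True \<open>s \<noteq> y\<close>
          by (auto simp: w_def indicator_def mult.assoc[symmetric] ennreal_mult[symmetric]
                simp del: power_Suc of_nat_Suc)
      qed
      also have "\<dots> = ennreal (erlang_density (Suc k) 1 y) * (\<integral>\<^sup>+u. H y (t + u) \<partial>exponential (1/2))"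
        using nn_integral_power_density_log[OF True, of "\<lambda>u. H y (t + u)" k]
        by (subst nn_integral_cmult) (simp_all add: c_def)
      finally show ?thesis .
    next
      case False
      then have "w s y = 0" for s by (auto simp: w_def indicator_def)
      moreover have "erlang_density (Suc k) 1 y = 0"
        using False by (cases "y = 0") (auto simp: erlang_density_def)
      ultimately show ?thesis by simp
    qed
    then show "(\<integral>\<^sup>+t. \<integral>\<^sup>+s. w s y * H y (t + c * ln (y / s)) \<partial>lborel \<partial>exponential_sum k)
      = ennreal (erlang_density (Suc k) 1 y) *
        (\<integral>\<^sup>+t. \<integral>\<^sup>+u. H y (t + u) \<partial>exponential (1/2) \<partial>exponential_sum k)"
      by (simp add: nn_integral_cmult)
  qed
  also have "\<dots> = (\<integral>\<^sup>+y. \<integral>\<^sup>+t. H y t \<partial>exponential_sum (Suc k) \<partial>density lborel (erlang_density (Suc k) 1))"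
  proof -
    interpret T': finite_measure "exponential_sum (Suc k)" by (rule finite_measure_exponential_sum)
    show ?thesis
      by (subst nn_integral_density) (simp_all del: exponential_sum.simps add: nn_integral_exponential_sum_Suc)
  qed
  finally show ?case by (simp add: H_def del: record_state.simps exponential_sum.simps)
qed

text \<open>The record and the remaining stream have probability laws independent of the statistic,
  so both integrate out and leave the law of T_{k+1}.\<close>

lemma emeasure_record_state:
  assumes [measurable]: "B \<in> sets borel"
  shows "emeasure expo.S {\<omega>. fst (snd (record_state (Suc k) \<omega>)) \<in> B}
    = emeasure (density lborel (erlang_density k (1/2))) B"
proof -
  let ?f = "\<lambda>x::real \<times> real \<times> real stream. indicator B (fst (snd x)) :: ennreal"
  have [measurable]: "(\<lambda>\<omega>. fst (snd (record_state (Suc k) \<omega>))) \<in> borel_measurable expo.S"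
    by (rule measurable_compose[OF measurable_record_state[of "Suc k", folded measurable_cong_sets[OF expo.sets_S refl]]])
       measurable
  interpret E: prob_space "density lborel (erlang_density (Suc k) 1)"
    by (rule prob_space_erlang_density) simp
  have "{\<omega>\<in>space expo.S. fst (snd (record_state (Suc k) \<omega>)) \<in> B} \<in> sets expo.S" by measurable
  then have "emeasure expo.S {\<omega>. fst (snd (record_state (Suc k) \<omega>)) \<in> B}
      = (\<integral>\<^sup>+\<omega>. indicator {\<omega>. fst (snd (record_state (Suc k) \<omega>)) \<in> B} \<omega> \<partial>expo.S)"
    by simp
  also have "\<dots> = (\<integral>\<^sup>+\<omega>. ?f (record_state (Suc k) \<omega>) \<partial>expo.S)"
    by (intro nn_integral_cong) (simp add: indicator_def)
  also have "\<dots> = (\<integral>\<^sup>+s. \<integral>\<^sup>+t. \<integral>\<^sup>+\<omega>. ?f (s, t, \<omega>) \<partial>expo.S \<partial>exponential_sum (Suc k)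
      \<partial>density lborel (erlang_density (Suc k) 1))"
    by (rule nn_integral_record_state) (measurable, simp add: indicator_def)
  also have "\<dots> = emeasure (exponential_sum (Suc k)) B"
    using E.emeasure_space_1 expo.S.emeasure_space_1
    by (simp del: exponential_sum.simps)
  finally show ?thesis by (simp only: exponential_sum_eq_erlang)
qed

section \<open>Records of Weibull variables\<close>

lemma AE_exponential_stream:
  "AE \<omega> in expo.S. (\<forall>j. 0 < \<omega> !! j) \<and> (\<forall>s. \<exists>j. s < \<omega> !! j)"
proof -
  have "AE y in exponential 1. 0 < y"
    by (subst AE_density, simp)
       (rule AE_mp[OF AE_lborel_singleton[of 0]], auto simp: exponential_density_def)
  then have pos: "AE \<omega> in expo.S. \<forall>j. 0 < \<omega> !! j"
    using expo.AE_stream_all[of "\<lambda>y. 0 < y"] by (simp add: sset_range)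
  \<comment> \<open>One null set has to serve all real levels at once; countably many integer levels
    suffice, as they are unbounded.\<close>
  have "AE \<omega> in expo.S. \<forall>n::nat. \<exists>j. real n < \<omega> !! j"
    by (subst AE_all_countable)
       (auto intro!: expo.AE_exceeds simp: emeasure_exponential_greaterThan)
  then have "AE \<omega> in expo.S. \<forall>s. \<exists>j. s < \<omega> !! j"
  proof (rule AE_mp, intro AE_I2 impI allI)
    fix \<omega> s assume unbounded: "\<forall>n::nat. \<exists>j. real n < \<omega> !! j"
    obtain n :: nat where "s < real n" using reals_Archimedean2 by blast
    moreover obtain j where "real n < \<omega> !! j" using unbounded by blast
    ultimately have "s < \<omega> !! j" by simp
    then show "\<exists>j. s < \<omega> !! j" ..
  qed
  with pos show ?thesis by eventually_elim simp
qed

section \<open>Records of a stream as states of the chain\<close>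

lemma Least_shift:
  fixes P :: "nat \<Rightarrow> bool"
  assumes "\<And>i. i < m \<Longrightarrow> \<not> P i" and "P j"
  shows "(LEAST j. P j) = m + (LEAST j. P (m + j))"
proof (rule Least_equality)
  have "m \<le> j" using assms by (meson not_le)
  then have "P (m + (j - m))" using assms(2) by simp
  then show "P (m + (LEAST j. P (m + j)))" by (rule LeastI)
  show "m + (LEAST j. P (m + j)) \<le> i" if "P i" for i
  proof -
    have "m \<le> i" using assms(1) that by (meson not_le)
    moreover from this have "(LEAST j. P (m + j)) \<le> i - m" using that by (intro Least_le) simp
    ultimately show ?thesis by simp
  qed
qed

abbreviation "stream_record \<equiv> record_value (\<lambda>j \<omega>. \<omega> !! j)"
abbreviation "stream_record_time \<equiv> record_time (\<lambda>j \<omega>. \<omega> !! j)"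

text \<open>The second conjunct is the invariant that reconciles the two searches:
  \<open>record_time\<close> starts again at index 0, \<open>record_step\<close> only after the
  current record. As no entry up to the record time exceeds the record, both find the same
  index.\<close>

lemma record_state_eq:
  assumes pos: "\<And>j. 0 < \<omega> !! j" and unbounded: "\<And>s. \<exists>j. s < \<omega> !! j"
  shows "record_state k \<omega> = (stream_record k \<omega>,
      2 * (\<Sum>i=0..k. ln (stream_record k \<omega> / stream_record i \<omega>)),
      sdrop (Suc (stream_record_time k \<omega>)) \<omega>)
    \<and> (\<forall>i\<le>stream_record_time k \<omega>. \<omega> !! i \<le> stream_record k \<omega>)"
proof (induction k)
  case 0
  have "0 < shd \<omega>" using pos[of 0] by simp
  then show ?case by (simp add: record_value_def)
next
  case (Suc k)
  let ?T = "stream_record_time k \<omega>" and ?T' = "stream_record_time (Suc k) \<omega>"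
  let ?R = "\<lambda>k. stream_record k \<omega>"
  have max: "\<omega> !! i \<le> ?R k" if "i \<le> ?T" for i using Suc that by blast
  have T': "?T' = (LEAST j. ?R k < \<omega> !! j)" by (simp add: record_value_def)
  obtain j where j: "?R k < \<omega> !! j" using unbounded by blast
  have less: "?R k < ?R (Suc k)"
    using LeastI[of "\<lambda>j. ?R k < \<omega> !! j", OF j] by (simp add: record_value_def)
  have idx: "?T' = Suc ?T + exceed_index (?R k) (sdrop (Suc ?T) \<omega>)"
    unfolding T' exceed_index_def sdrop_snth
    using max j by (intro Least_shift[where j = j]) (auto simp: not_less)
  have val: "exceed_value (?R k) (sdrop (Suc ?T) \<omega>) = ?R (Suc k)"
    unfolding exceed_value_def sdrop_snth record_value_def[of _ "Suc k"] idx ..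
  have rest: "exceed_rest (?R k) (sdrop (Suc ?T) \<omega>) = sdrop (Suc ?T') \<omega>"
    unfolding exceed_rest_def sdrop_add idx by (simp del: sdrop.simps)
  have Rpos: "0 < ?R i" for i using pos by (simp add: record_value_def)
  \<comment> \<open>All k+1 old summands grow by the same amount and the new summand is ln 1 = 0;
    this is the origin of the factor k+1 in \<open>record_step\<close>.\<close>
  have "ln (?R (Suc k) / ?R i) = ln (?R (Suc k) / ?R k) + ln (?R k / ?R i)" for i
    using Rpos[of "Suc k"] Rpos[of k] Rpos[of i] by (simp add: ln_div)
  then have "(\<Sum>i=0..k. ln (?R (Suc k) / ?R i)) = (\<Sum>i=0..k. ln (?R (Suc k) / ?R k) + ln (?R k / ?R i))"
    by (rule sum.cong[OF refl])
  moreover have "ln (?R (Suc k) / ?R (Suc k)) = 0" using Rpos[of "Suc k"] by simp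
  ultimately have "(\<Sum>i=0..Suc k. ln (?R (Suc k) / ?R i))
      = (\<Sum>i=0..k. ln (?R (Suc k) / ?R k) + ln (?R k / ?R i))"
    by (simp only: sum.atLeast0_atMost_Suc add_0_right)
  also have "\<dots> = real (Suc k) * ln (?R (Suc k) / ?R k) + (\<Sum>i=0..k. ln (?R k / ?R i))"
    by (simp add: sum.distrib)
  finally have sum: "(\<Sum>i=0..Suc k. ln (?R (Suc k) / ?R i)) = \<dots>" .
  have "record_state (Suc k) \<omega> = record_step k (?R k, 2 * (\<Sum>i=0..k. ln (?R k / ?R i)), sdrop (Suc ?T) \<omega>)"
    using Suc by simp
  also have "\<dots> = (?R (Suc k), 2 * (\<Sum>i=0..Suc k. ln (?R (Suc k) / ?R i)), sdrop (Suc ?T') \<omega>)"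
    unfolding record_step_def prod.case val rest sum by (simp add: algebra_simps)
  finally have state: "record_state (Suc k) \<omega> = \<dots>" .
  have "\<omega> !! i \<le> ?R (Suc k)" if "i \<le> ?T'" for i
  proof (cases "i = ?T'")
    case True
    then show ?thesis by (simp add: record_value_def)
  next
    case False
    then have "\<not> ?R k < \<omega> !! i" using that unfolding T' by (intro not_less_Least) simp
    then show ?thesis using less by simp
  qed
  with state show ?case by blast
qed

section \<open>Reduction of Weibull records to exponential records\<close>

lemma powr_scale_less_iff:
  fixes x y \<alpha> \<beta> :: real
  assumes "0 < \<alpha>" "0 < \<beta>" "0 < x" "0 < y"
  shows "(x / \<alpha>) powr \<beta> < (y / \<alpha>) powr \<beta> \<longleftrightarrow> x < y"
proof -
  have "(x / \<alpha>) powr \<beta> < (y / \<alpha>) powr \<beta> \<longleftrightarrow> x / \<alpha> < y / \<alpha>"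
    using assms powr_less_mono2[of \<beta> "x / \<alpha>" "y / \<alpha>"] powr_mono2[of \<beta> "y / \<alpha>" "x / \<alpha>"]
    by (cases "x / \<alpha> < y / \<alpha>") (auto simp: not_less)
  then show ?thesis using assms by (simp add: divide_less_cancel)
qed

text \<open>Record times depend only on comparisons between entries, which a strictly increasing map
  preserves. The two \<open>LEAST\<close> predicates are equivalent, so even unspecified indices
  agree.\<close>

lemma stream_record_powr:
  fixes X :: "nat \<Rightarrow> 'a \<Rightarrow> real"
  assumes "0 < \<alpha>" "0 < \<beta>" and "\<And>j. 0 < X j \<omega>"
  shows "stream_record k (to_stream (\<lambda>j. (X j \<omega> / \<alpha>) powr \<beta>)) = (record_value X k \<omega> / \<alpha>) powr \<beta>"
proof -
  have snth: "to_stream (\<lambda>j. (X j \<omega> / \<alpha>) powr \<beta>) !! j = (X j \<omega> / \<alpha>) powr \<beta>" for j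
    by (simp add: to_stream_def)
  have "stream_record_time k (to_stream (\<lambda>j. (X j \<omega> / \<alpha>) powr \<beta>)) = record_time X k \<omega>"
    using assms by (induction k) (simp_all add: snth powr_scale_less_iff)
  then show ?thesis by (simp add: record_value_def snth)
qed

text \<open>The scale \<alpha> cancels in the ratio and the exponent \<beta> comes out of the
  logarithm, which makes the statistic a pivot.\<close>

lemma ln_stream_record_powr:
  fixes X :: "nat \<Rightarrow> 'a \<Rightarrow> real"
  assumes "0 < \<alpha>" "0 < \<beta>" and "\<And>j. 0 < X j \<omega>"
  defines "y \<equiv> to_stream (\<lambda>j. (X j \<omega> / \<alpha>) powr \<beta>)"
  shows "ln (stream_record k y / stream_record i y) = \<beta> * ln (record_value X k \<omega> / record_value X i \<omega>)"
proof -
  have R: "0 < record_value X k \<omega>" for k using assms by (simp add: record_value_def)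
  show ?thesis
    unfolding y_def stream_record_powr[of \<alpha> \<beta> X \<omega>, OF assms(1-3)]
    using R[of k] R[of i] assms(1,2) by (simp add: ln_div ln_powr algebra_simps)
qed

lemma (in prob_space) AE_weibull_pos:
  fixes Z :: "'a \<Rightarrow> real"
  assumes [measurable]: "Z \<in> borel_measurable M"
    and cdf: "\<And>x. cdf (distr M borel Z) x = weibull_cdf \<alpha> \<beta> x"
  shows "AE \<omega> in M. 0 < Z \<omega>"
proof -
  have "measure M (Z -` {..0} \<inter> space M) = 0"
    using cdf[of 0] by (simp add: cdf_def measure_distr weibull_cdf_def)
  then have "emeasure M {\<omega>\<in>space M. \<not> 0 < Z \<omega>} = 0"
    by (simp add: emeasure_eq_measure vimage_def Int_def conj_commute not_less)
  then show ?thesis by (subst AE_iff_measurable[OF _ refl]) simp_all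
qed

lemma (in prob_space) weibull_powr_exponential:
  fixes Z :: "'a \<Rightarrow> real"
  assumes pos: "0 < \<alpha>" "0 < \<beta>" and [measurable]: "Z \<in> borel_measurable M"
    and cdf: "\<And>x. cdf (distr M borel Z) x = weibull_cdf \<alpha> \<beta> x"
  shows "distributed M lborel (\<lambda>\<omega>. (Z \<omega> / \<alpha>) powr \<beta>) (exponential_density 1)"
proof (rule exponential_distributedI)
  fix a :: real assume a: "0 \<le> a"
  \<comment> \<open>b is the preimage of a under the map x to (x / \<alpha>) powr \<beta>. The case
    a = 0 is treated apart below, since there b = 0 lies outside the positive range of the order
    equivalence and of the Weibull formula.\<close>
  define b where "b = \<alpha> * a powr (1 / \<beta>)"
  have b: "(b / \<alpha>) powr \<beta> = a" using pos a by (simp add: b_def powr_powr)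
  have "emeasure M {\<omega>\<in>space M. (Z \<omega> / \<alpha>) powr \<beta> \<le> a} = emeasure M {\<omega>\<in>space M. Z \<omega> \<le> b}"
  proof (rule emeasure_eq_AE)
    show "AE \<omega> in M. \<omega> \<in> {\<omega>\<in>space M. (Z \<omega> / \<alpha>) powr \<beta> \<le> a} \<longleftrightarrow> \<omega> \<in> {\<omega>\<in>space M. Z \<omega> \<le> b}"
      using AE_weibull_pos[OF assms(3) cdf]
    proof eventually_elim
      fix \<omega> assume Z: "0 < Z \<omega>"
      show "\<omega> \<in> {\<omega>\<in>space M. (Z \<omega> / \<alpha>) powr \<beta> \<le> a} \<longleftrightarrow> \<omega> \<in> {\<omega>\<in>space M. Z \<omega> \<le> b}"
      proof (cases "a = 0")
        case True
        then show ?thesis using Z pos by (auto simp: b_def not_le)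
      next
        case False
        then have "0 < b" using pos a by (simp add: b_def)
        then show ?thesis using powr_scale_less_iff[OF pos, of b "Z \<omega>"] Z b by (auto simp flip: not_less)
      qed
    qed
  qed measurable
  also have "\<dots> = ennreal (cdf (distr M borel Z) b)"
    by (simp add: cdf_def measure_distr emeasure_eq_measure vimage_def Int_def conj_commute)
  also have "cdf (distr M borel Z) b = 1 - exp (- a)"
  proof (cases "a = 0")
    case True
    then show ?thesis using cdf by (simp add: b_def weibull_cdf_def)
  next
    case False
    then have "0 < b" using pos a by (simp add: b_def)
    then show ?thesis using cdf b by (simp add: weibull_cdf_def)
  qed
  finally show "emeasure M {\<omega>\<in>space M. (Z \<omega> / \<alpha>) powr \<beta> \<le> a} = 1 - ennreal (exp (- a * 1))"
    by (simp add: ennreal_minus flip: ennreal_1)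
qed simp_all

text \<open>Independence says that the joint law is the product measure, and
  \<open>stream_space\<close> is the image of the infinite product under
  \<open>to_stream\<close>.\<close>

lemma (in prob_space) distr_to_stream_indep:
  fixes Y :: "nat \<Rightarrow> 'a \<Rightarrow> real"
  assumes "indep_vars (\<lambda>_. borel) Y UNIV" and law: "\<And>j. distr M borel (Y j) = \<mu>"
  shows "distr M (stream_space borel) (\<lambda>\<omega>. to_stream (\<lambda>j. Y j \<omega>)) = stream_space \<mu>"
proof -
  have [measurable]: "Y j \<in> borel_measurable M" for j
    using assms(1) by (auto simp: indep_vars_def)
  have sets [measurable_cong]: "sets \<mu> = sets borel" using law[of 0] by auto
  have "(\<Pi>\<^sub>M i\<in>UNIV. \<mu>) = distr M (\<Pi>\<^sub>M i\<in>UNIV. borel) (\<lambda>\<omega>. \<lambda>i\<in>UNIV. Y i \<omega>)"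
    using assms by (subst (asm) indep_vars_iff_distr_eq_PiM') auto
  then have "stream_space \<mu> = distr (distr M (\<Pi>\<^sub>M i\<in>UNIV. borel) (\<lambda>\<omega> i. Y i \<omega>)) (stream_space \<mu>) to_stream"
    using stream_space_eq_distr[of \<mu>] by (simp add: restrict_def)
  also have "\<dots> = distr M (stream_space \<mu>) (to_stream \<circ> (\<lambda>\<omega> i. Y i \<omega>))"
    by (rule distr_distr) (measurable, simp_all add: measurable_PiM_single')
  also have "\<dots> = distr M (stream_space borel) (\<lambda>\<omega>. to_stream (\<lambda>j. Y j \<omega>))"
    using sets_stream_space_cong[OF sets] by (intro distr_cong) auto
  finally show ?thesis by simp
qed

lemma measurable_record_value:
  fixes X :: "nat \<Rightarrow> 'a \<Rightarrow> real"
  assumes [measurable]: "\<And>j. X j \<in> borel_measurable M"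
  shows "record_value X k \<in> borel_measurable M"
proof -
  have comp: "(\<lambda>\<omega>. X (f \<omega>) \<omega>) \<in> borel_measurable M" if "f \<in> measurable M (count_space UNIV)" for f
    by (rule measurable_compose_countable[OF _ that]) (rule assms)
  have "record_time X k \<in> measurable M (count_space UNIV)"
  proof (induction k)
    case 0
    have "record_time X 0 = (\<lambda>_. 0)" by (simp add: fun_eq_iff)
    then show ?case by simp
  next
    case (Suc k)
    note [measurable] = comp[OF Suc]
    have "record_time X (Suc k) = (\<lambda>\<omega>. LEAST j. X j \<omega> > X (record_time X k \<omega>) \<omega>)"
      by (simp add: fun_eq_iff)
    moreover have "(\<lambda>\<omega>. LEAST j. X j \<omega> > X (record_time X k \<omega>) \<omega>) \<in> measurable M (count_space UNIV)"
      by measurable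
    ultimately show ?case by (simp only:)
  qed
  from comp[OF this] show ?thesis by (simp only: record_value_def[abs_def])
qed

section \<open>Chi-square laws with even degrees of freedom and their quantiles\<close>

lemma chi_square_eq_erlang: "chi_square (2 * Suc k) = density lborel (erlang_density k (1/2))"
  unfolding chi_square_def
proof (rule density_cong)
  show "(\<lambda>x. ennreal (chi_square_density (2 * Suc k) x)) \<in> borel_measurable lborel"
    unfolding chi_square_density_def by measurable
  show "AE x in lborel. ennreal (chi_square_density (2 * Suc k) x) = ennreal (erlang_density k (1/2) x)"
  \<comment> \<open>At 0 the conventions differ: the chi-square density is set to 0, the Erlang
    density with k = 0 equals 1/2.\<close>
  proof (rule AE_mp[OF AE_lborel_singleton[of 0]], intro AE_I2 impI)
    fix x :: real assume "x \<noteq> 0"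
    have half: "real (2 * Suc k) / 2 = real (Suc k)" by simp
    have "x powr (real (Suc k) - 1) = x ^ k" if "0 < x" using that by (simp add: powr_realpow)
    moreover have "2 powr real (Suc k) = (2::real) ^ Suc k" by (rule powr_realpow) simp
    moreover have "Gamma (real (Suc k)) = fact k" using Gamma_fact[of k, where 'a = real] by (simp add: add.commute)
    ultimately show "ennreal (chi_square_density (2 * Suc k) x) = ennreal (erlang_density k (1/2) x)"
      using \<open>x \<noteq> 0\<close> unfolding chi_square_density_def erlang_density_def half
      by (auto simp: power_one_over field_simps simp del: of_nat_Suc power_Suc)
  qed
qed simp

text \<open>The \<open>THE\<close> in the quantile requires existence and uniqueness. Existence
  follows from the intermediate value theorem, as a law with a density has a continuous distribution
  function; uniqueness follows from positivity of the density on the positive axis.\<close>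

lemma chi_square_quantile:
  fixes k :: nat
  assumes "0 < \<delta>" "\<delta> < 1"
  defines "q \<equiv> chi_square_quantile (2 * Suc k) \<delta>"
  shows "0 < q" and "measure (chi_square (2 * Suc k)) {..q} = \<delta>"
proof -
  let ?D = "density lborel (erlang_density k (1/2))"
  interpret D: prob_space ?D by (rule prob_space_erlang_density) simp
  interpret D: real_distribution ?D by standard auto
  have cdf0: "cdf ?D 0 = 0"
    using emeasure_erlang_density[of "1/2" k 0]
    by (simp add: cdf_def measure_def erlang_CDF_def sum.atMost_shift)
  have pos: "0 < c" if "cdf ?D c = \<delta>" for c
    using D.cdf_nondecreasing[of c 0] that cdf0 assms(1) by (cases "0 < c") auto
  have "eventually (\<lambda>x. \<delta> < cdf ?D x) at_top"
    using D.cdf_lim_at_top_prob assms(2) by (rule order_tendstoD)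
  then obtain b where b: "\<delta> < cdf ?D b" by (auto simp: eventually_at_top_linorder)
  have "0 \<le> b" using D.cdf_nondecreasing[of b 0] b cdf0 assms(1) by (cases "0 \<le> b") auto
  have "isCont (cdf ?D) x" for x
  proof -
    have "AE z in lborel. z \<in> {x} \<longrightarrow> ennreal (erlang_density k (1/2) z) = 0"
      using AE_lborel_singleton[of x] by eventually_elim simp
    then have "{x} \<in> null_sets ?D" by (subst null_sets_density_iff) simp_all
    then show ?thesis by (simp add: D.isCont_cdf measure_def null_setsD1)
  qed
  then have "\<exists>c\<ge>0. c \<le> b \<and> cdf ?D c = \<delta>"
    using b \<open>0 \<le> b\<close> cdf0 assms(1) by (intro IVT) auto
  then obtain c where c: "cdf ?D c = \<delta>" by blast
  \<comment> \<open>If two points shared the level \<delta> > 0, the interval between them would lie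
    in the positive axis and have probability 0. The positive density would make it Lebesgue-null,
    despite its positive length.\<close>
  have uniq: False if "cdf ?D x = \<delta>" "cdf ?D y = \<delta>" "x < y" for x y
  proof -
    have "measure ?D {x<..y} = 0" using D.cdf_diff_eq[of x y] that by simp
    then have "{x<..y} \<in> null_sets ?D" by (auto simp: D.emeasure_eq_measure)
    then have "AE z in lborel. z \<in> {x<..y} \<longrightarrow> ennreal (erlang_density k (1/2) z) = 0"
      by (subst (asm) null_sets_density_iff) auto
    then have "AE z in lborel. z \<notin> {x<..y}"
    proof (rule AE_mp, intro AE_I2 impI)
      fix z assume z: "z \<in> {x<..y} \<longrightarrow> ennreal (erlang_density k (1/2) z) = 0"
      have "0 < erlang_density k (1/2) z" if "z \<in> {x<..y}"
        using pos[OF \<open>cdf ?D x = \<delta>\<close>] that by (simp add: erlang_density_def)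
      with z show "z \<notin> {x<..y}" by (auto simp: ennreal_eq_0_iff)
    qed
    then have "{x<..y} \<in> null_sets lborel" by (subst AE_iff_null_sets) simp_all
    then show False using that by (simp add: null_sets_def)
  qed
  have eq: "x = c" if "measure ?D {..x} = \<delta>" for x
    using uniq[of x c] uniq[of c x] c that unfolding cdf_def by (cases x c rule: linorder_cases) auto
  have c': "measure ?D {..c} = \<delta>" using c unfolding cdf_def .
  have "q = c"
    unfolding q_def chi_square_quantile_def chi_square_eq_erlang by (rule the_equality) (rule c', rule eq)
  then show "0 < q" "measure (chi_square (2 * Suc k)) {..q} = \<delta>"
    using c' pos[OF c] unfolding chi_square_eq_erlang by (simp_all only:)
qed

lemma measure_chi_square_between_quantiles:
  assumes "0 < \<delta>\<^sub>1" "\<delta>\<^sub>1 < \<delta>\<^sub>2" "\<delta>\<^sub>2 < 1"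
  shows "measure (chi_square (2 * Suc k))
      {chi_square_quantile (2 * Suc k) \<delta>\<^sub>1<..<chi_square_quantile (2 * Suc k) \<delta>\<^sub>2} = \<delta>\<^sub>2 - \<delta>\<^sub>1"
proof -
  let ?D = "density lborel (erlang_density k (1/2))"
  interpret D: prob_space ?D by (rule prob_space_erlang_density) simp
  interpret D: real_distribution ?D by standard auto
  let ?q = "chi_square_quantile (2 * Suc k)"
  have cdf: "cdf ?D (?q \<delta>\<^sub>1) = \<delta>\<^sub>1" "cdf ?D (?q \<delta>\<^sub>2) = \<delta>\<^sub>2"
    using chi_square_quantile(2)[of \<delta>\<^sub>1 k] chi_square_quantile(2)[of \<delta>\<^sub>2 k] assms
    by (simp_all add: cdf_def chi_square_eq_erlang del: mult_Suc_right)
  then have "?q \<delta>\<^sub>1 < ?q \<delta>\<^sub>2"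
    using D.cdf_nondecreasing[of "?q \<delta>\<^sub>2" "?q \<delta>\<^sub>1"] assms by (cases "?q \<delta>\<^sub>1 < ?q \<delta>\<^sub>2") auto
  then have "measure ?D {?q \<delta>\<^sub>1<..?q \<delta>\<^sub>2} = \<delta>\<^sub>2 - \<delta>\<^sub>1"
    using D.cdf_diff_eq[of "?q \<delta>\<^sub>1" "?q \<delta>\<^sub>2"] cdf by simp
  \<comment> \<open>Differences of the distribution function measure half-open intervals; the right
    endpoint carries no mass.\<close>
  moreover have "measure ?D {?q \<delta>\<^sub>1<..<?q \<delta>\<^sub>2} = measure ?D {?q \<delta>\<^sub>1<..?q \<delta>\<^sub>2}"
  proof (rule D.finite_measure_eq_AE)
    show "AE x in ?D. x \<in> {?q \<delta>\<^sub>1<..<?q \<delta>\<^sub>2} \<longleftrightarrow> x \<in> {?q \<delta>\<^sub>1<..?q \<delta>\<^sub>2}"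
      using AE_lborel_singleton[of "?q \<delta>\<^sub>2"] by (subst AE_density) (auto elim: eventually_mono)
  qed simp_all
  ultimately show ?thesis by (simp only: chi_square_eq_erlang)
qed

section \<open>Coverage probability of the interval\<close>

theorem mainTheorem2:
  fixes M :: "'a measure" and X :: "nat \<Rightarrow> 'a \<Rightarrow> real"
    and \<alpha> \<beta> \<gamma> :: real and n :: nat
  assumes "prob_space M"
    and "\<alpha> > 0" and "\<beta> > 0"
    and "n \<ge> 1"
    and "0 < \<gamma>" and "\<gamma> < 1"
    and "prob_space.indep_vars M (\<lambda>_. borel) X UNIV"
    and "\<And>j x. cdf (distr M borel (X j)) x = weibull_cdf \<alpha> \<beta> x"
  shows "measure M {\<omega> \<in> space M.
           \<beta> \<in> {chi_square_quantile (2 * n) (\<gamma> / 2)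
                  / (2 * (\<Sum>i=0..n. ln (record_value X n \<omega> / record_value X i \<omega>)))
               <..< chi_square_quantile (2 * n) (1 - \<gamma> / 2)
                  / (2 * (\<Sum>i=0..n. ln (record_value X n \<omega> / record_value X i \<omega>)))}}
         = 1 - \<gamma>"
proof -
  interpret prob_space M by fact
  obtain k where n: "n = Suc k" using assms(4) by (cases n) auto
  define q\<^sub>1 where "q\<^sub>1 = chi_square_quantile (2 * n) (\<gamma> / 2)"
  define q\<^sub>2 where "q\<^sub>2 = chi_square_quantile (2 * n) (1 - \<gamma> / 2)"
  have q: "0 < q\<^sub>1" "0 < q\<^sub>2"
    using chi_square_quantile(1)[of "\<gamma> / 2" k] chi_square_quantile(1)[of "1 - \<gamma> / 2" k] assms(5,6)
    by (simp_all add: q\<^sub>1_def q\<^sub>2_def n)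
  define y where "y \<omega> = to_stream (\<lambda>j. (X j \<omega> / \<alpha>) powr \<beta>)" for \<omega>
  define Q where "Q \<omega> = (\<Sum>i=0..n. ln (record_value X n \<omega> / record_value X i \<omega>))" for \<omega>
  define t where "t \<omega> = fst (snd (record_state n \<omega>))" for \<omega>

  have X [measurable]: "X j \<in> borel_measurable M" for j
    using assms(7) by (auto simp: indep_vars_def)
  note [measurable] = measurable_record_value[of X, OF X]
  have [measurable]: "Q \<in> borel_measurable M" unfolding Q_def by measurable
  have "record_state n \<in> measurable (stream_space borel) state_space" by measurable
  then have t [measurable]: "t \<in> borel_measurable (stream_space borel)" unfolding t_def by measurable
  have y [measurable]: "y \<in> measurable M (stream_space borel)"
    unfolding y_def by (rule measurable_stream_space2) (simp add: to_stream_def)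

  have "distr M borel (\<lambda>\<omega>. (X j \<omega> / \<alpha>) powr \<beta>) = exponential 1" for j
    using distributed_distr_eq_density[OF weibull_powr_exponential[OF assms(2,3) X assms(8), of j]]
    by (simp cong: distr_cong)
  moreover have "indep_vars (\<lambda>_. borel) (\<lambda>j \<omega>. (X j \<omega> / \<alpha>) powr \<beta>) UNIV"
    using assms(7) by (rule indep_vars_compose2) simp
  ultimately have law: "distr M (stream_space borel) y = expo.S"
    unfolding y_def by (intro distr_to_stream_indep)

  have "AE \<omega> in M. \<forall>j. 0 < X j \<omega>"
    by (subst AE_all_countable) (blast intro: AE_weibull_pos[OF X assms(8)])
  moreover have "AE \<omega> in M. (\<forall>j. 0 < y \<omega> !! j) \<and> (\<forall>s. \<exists>j. s < y \<omega> !! j)"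
    using AE_exponential_stream unfolding law[symmetric] by (rule AE_distrD[OF y])
  \<comment> \<open>This is the pivotal identity: the left side has a law free of \<alpha> and
    \<beta>, the right side is computed from the Weibull records. It holds off the null set where
    positivity or unboundedness fails.\<close>
  ultimately have t_eq: "AE \<omega> in M. t (y \<omega>) = 2 * \<beta> * Q \<omega>"
  proof eventually_elim
    fix \<omega> assume X: "\<forall>j. 0 < X j \<omega>" and Y: "(\<forall>j. 0 < y \<omega> !! j) \<and> (\<forall>s. \<exists>j. s < y \<omega> !! j)"
    have "ln (stream_record n (y \<omega>) / stream_record i (y \<omega>))
        = \<beta> * ln (record_value X n \<omega> / record_value X i \<omega>)" for i
      unfolding y_def using assms(2,3) X by (intro ln_stream_record_powr) auto
    then show "t (y \<omega>) = 2 * \<beta> * Q \<omega>"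
      using record_state_eq[of "y \<omega>" n] Y by (simp add: t_def Q_def sum_distrib_left mult.assoc)
  qed

  \<comment> \<open>For Q \<le> 0 both sides are false: the upper endpoint is at most 0, since
    division by 0 gives 0, and 2 \<beta> Q lies below the positive lower quantile. Hence the
    equivalence holds at every point.\<close>
  have iff: "\<beta> \<in> {q\<^sub>1 / (2 * Q \<omega>)<..<q\<^sub>2 / (2 * Q \<omega>)} \<longleftrightarrow> 2 * \<beta> * Q \<omega> \<in> {q\<^sub>1<..<q\<^sub>2}" for \<omega>
  proof (cases "0 < Q \<omega>")
    case True
    then show ?thesis by (simp add: field_simps)
  next
    case False
    then have "\<beta> * Q \<omega> \<le> 0" and "q\<^sub>2 / (2 * Q \<omega>) \<le> 0"
      using assms(3) q by (simp_all add: mult_nonneg_nonpos divide_nonneg_nonpos)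
    then show ?thesis using assms(3) q by auto
  qed
  have "measure M {\<omega>\<in>space M. \<beta> \<in> {q\<^sub>1 / (2 * Q \<omega>)<..<q\<^sub>2 / (2 * Q \<omega>)}}
      = measure M {\<omega>\<in>space M. t (y \<omega>) \<in> {q\<^sub>1<..<q\<^sub>2}}"
    using t_eq unfolding iff by (intro finite_measure_eq_AE) (auto intro: AE_mp)
  also have "\<dots> = measure (distr M (stream_space borel) y) {\<omega>. t \<omega> \<in> {q\<^sub>1<..<q\<^sub>2}}"
  proof -
    have "{\<omega>\<in>space (stream_space borel). t \<omega> \<in> {q\<^sub>1<..<q\<^sub>2}} \<in> sets (stream_space borel)" by measurable
    then show ?thesis
      by (subst measure_distr) (auto simp: space_stream_space intro!: arg_cong[where f = "measure M"])
  qed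
  also have "\<dots> = measure (chi_square (2 * Suc k)) {q\<^sub>1<..<q\<^sub>2}"
    using emeasure_record_state[of "{q\<^sub>1<..<q\<^sub>2}" k]
    unfolding law by (simp add: measure_def t_def n chi_square_eq_erlang del: mult_Suc_right record_state.simps)
  also have "\<dots> = (1 - \<gamma> / 2) - \<gamma> / 2"
    using assms(5,6) unfolding q\<^sub>1_def q\<^sub>2_def n by (intro measure_chi_square_between_quantiles) auto
  finally show ?thesis by (simp add: q\<^sub>1_def q\<^sub>2_def Q_def)
qed

end
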